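(* Let $G$ be a finite simple graph with no isolated vertices that is $C_5$-free and not isomorphic to any of the following graphs: (1) the complete bipartite graph $K_{2,m}$ for some $m\ge 2$; (2) the wheel consisting of a $4$-cycle together with one vertex adjacent to all four cycle vertices; (3) the complete tripartite graph $K_{2,2,2}$ (octahedron). Then $G$ is $C_4$-free if and only if $G/e$ is $C_4$-free for every edge $e\in E(G)$.
   Context: All graphs are finite and simple. $C_n$ is the cycle on $n$ vertices. A graph is $H$-free if it has no induced subgraph isomorphic to $H$. For an edge $e=uv$ of $G$, the contraction $G/e$ is obtained from $G$ by deleting $u$ and $v$ and adding a new vertex adjacent to every vertex of $(N(u)\cup N(v))\setminus\{u,v\}$. *)

theory Defs
  imports "Graph_Theory.Graph_Theory"
begin

text \<open>
  A finite simple graph is a \<^locale>\<open>pair_graph\<close>: a finite, symmetric, loop-free set of arcs without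
  parallel arcs. An undirected edge \<open>uv\<close> is the pair of arcs \<open>(u, v)\<close> and \<open>(v, u)\<close>.
\<close>

text \<open>Only meaningful for \<open>n \<ge> 3\<close>.\<close>

definition cycle_graph :: "nat \<Rightarrow> nat pair_pre_digraph" where
  "cycle_graph n = \<lparr> pverts = {..<n},
     parcs = {(i, j). i < n \<and> j < n \<and> (j = Suc i mod n \<or> i = Suc j mod n)} \<rparr>"

text \<open>The hub is \<^const>\<open>None\<close>; the index \<open>n\<close> is the length of the rim.\<close>

definition wheel_graph :: "nat \<Rightarrow> nat option pair_pre_digraph" where
  "wheel_graph n = \<lparr> pverts = insert None (Some ` {..<n}),
     parcs = {(Some i, Some j) | i j. (i, j) \<in> parcs (cycle_graph n)}
       \<union> {(None, Some i) | i. i < n} \<union> {(Some i, None) | i. i < n} \<rparr>"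

text \<open>The vertex \<open>(i, k)\<close> is the \<open>k\<close>-th vertex of the \<open>i\<close>-th part, which has size \<open>ns ! i\<close>.\<close>

definition complete_multipartite_graph :: "nat list \<Rightarrow> (nat \<times> nat) pair_pre_digraph" where
  "complete_multipartite_graph ns = (let V = {(i, k). i < length ns \<and> k < ns ! i} in
     \<lparr> pverts = V, parcs = {(x, y). x \<in> V \<and> y \<in> V \<and> fst x \<noteq> fst y} \<rparr>)"

definition graph_iso :: "'a pair_pre_digraph \<Rightarrow> 'b pair_pre_digraph \<Rightarrow> bool" where
  "graph_iso G H \<longleftrightarrow> digraph_iso (with_proj G) (with_proj H)"

definition induced_free :: "'b pair_pre_digraph \<Rightarrow> 'a pair_pre_digraph \<Rightarrow> bool" where
  "induced_free H G \<longleftrightarrow>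
     \<not> (\<exists>S. induced_subgraph (with_proj S) (with_proj G) \<and> graph_iso S H)"

definition neighbours :: "'a pair_pre_digraph \<Rightarrow> 'a \<Rightarrow> 'a set" where
  "neighbours G v = {w. (v, w) \<in> parcs G}"

definition no_isolated_verts :: "'a pair_pre_digraph \<Rightarrow> bool" where
  "no_isolated_verts G \<longleftrightarrow> (\<forall>v \<in> pverts G. neighbours G v \<noteq> {})"

text \<open>
  The vertex type is lifted to \<^typ>\<open>'a option\<close> so that \<^const>\<open>None\<close> can serve as the new vertex even
  if \<open>G\<close> uses every element of \<^typ>\<open>'a\<close>. The result does not depend on the orientation of
  the contracted arc.
\<close>

fun contract_edge :: "'a pair_pre_digraph \<Rightarrow> 'a \<times> 'a \<Rightarrow> 'a option pair_pre_digraph" where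
  "contract_edge G (u, v) = (let N = (neighbours G u \<union> neighbours G v) - {u, v} in
     \<lparr> pverts = insert None (Some ` (pverts G - {u, v})),
       parcs = {(Some x, Some y) | x y. (x, y) \<in> parcs G \<and> x \<notin> {u, v} \<and> y \<notin> {u, v}}
         \<union> {(None, Some x) | x. x \<in> N} \<union> {(Some x, None) | x. x \<in> N} \<rparr>)"

end

theory Submission
  imports Defs
begin

text \<open>
  An induced 4-cycle of \<open>G/uv\<close> that uses the new vertex pulls back to an induced 4-cycle or 5-cycle of
  \<open>G\<close>, which settles one direction. For the other, let \<open>a b c d\<close> be an induced 4-cycle of \<open>G\<close> and let
  every contraction be \<open>C\<^sub>4\<close>-free. No edge can avoid the cycle, and a vertex off the cycle that sees \<open>a\<close>
  must see \<open>c\<close>, since otherwise contracting that edge leaves an induced 4-cycle. Hence each outer vertex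
  sees exactly \<open>{a, c}\<close>, exactly \<open>{b, d}\<close>, or the whole cycle. Applying the same two facts to the
  4-cycle \<open>a b c x\<close>, where \<open>x\<close> is of type \<open>{a, c}\<close>, shows that all outer vertices are of one type.
  The first two types give \<open>K\<^sub>2\<^sub>,\<^sub>m\<close>. In the third type there are at most two outer vertices \<open>x, y\<close>, because
  for a third one \<open>z\<close> the edge \<open>zb\<close> avoids the 4-cycle \<open>a x c y\<close>; this leaves \<open>C\<^sub>4 = K\<^sub>2\<^sub>,\<^sub>2\<close>, the wheel and
  the octahedron.
\<close>

section \<open>Isomorphisms and induced copies in terms of vertex maps\<close>

lemma graph_isoI:
  assumes "pair_wf_digraph G" "pair_wf_digraph H"
    and "inj_on f (pverts G)" "f ` pverts G = pverts H"
    and arcs: "\<And>x y. x \<in> pverts G \<Longrightarrow> y \<in> pverts G \<Longrightarrow> (f x, f y) \<in> parcs H \<longleftrightarrow> (x, y) \<in> parcs G"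
  shows "graph_iso G H"
proof -
  interpret G: pair_wf_digraph G by fact
  interpret H: pair_wf_digraph H by fact
  \<comment> \<open>A digraph isomorphism also carries an arc map and new head and tail functions.
    Here arcs are pairs, so \<open>f\<close> determines all of them.\<close>
  let ?h = "\<lparr>iso_verts = f, iso_arcs = map_prod f f, iso_head = snd, iso_tail = fst\<rparr>"
  have "inj_on (map_prod f f) (parcs G)"
    by (rule inj_on_subset[OF map_prod_inj_on[OF assms(3) assms(3)]])
      (auto dest: G.in_arcsD1 G.in_arcsD2)
  then have "pre_digraph.digraph_isomorphism (with_proj G) ?h"
    using assms(3) G.wf_digraph_axioms by (simp add: pre_digraph.digraph_isomorphism_def)
  moreover have "parcs H = map_prod f f ` parcs G"
  proof (intro subset_antisym subrelI)
    fix p q assume *: "(p, q) \<in> parcs H"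
    then obtain x y where "x \<in> pverts G" "y \<in> pverts G" "p = f x" "q = f y"
      using assms(4) H.in_arcsD1 H.in_arcsD2 by blast
    then show "(p, q) \<in> map_prod f f ` parcs G"
      using * arcs by force
  qed (use arcs in \<open>auto dest: G.in_arcsD1 G.in_arcsD2\<close>)
  then have "with_proj H = app_iso ?h (with_proj G)"
    using assms(4) by (simp add: with_proj_def app_iso_def)
  ultimately show ?thesis
    unfolding graph_iso_def digraph_iso_def by blast
qed

lemma graph_isoE:
  assumes "graph_iso G H"
  obtains f where "pair_wf_digraph G" "inj_on f (pverts G)" "pverts H = f ` pverts G"
    "parcs H = map_prod f f ` parcs G"
proof -
  obtain h where h: "pre_digraph.digraph_isomorphism (with_proj G) h"
    and H: "with_proj H = app_iso h (with_proj G)"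
    using assms by (auto simp: graph_iso_def digraph_iso_def)
  have eqs: "pverts H = iso_verts h ` pverts G" "parcs H = iso_arcs h ` parcs G"
    "iso_tail h = fst" "iso_head h = snd"
    using H by (auto simp: with_proj_def app_iso_def)
  \<comment> \<open>Tail and head in the target are again \<open>fst\<close> and \<open>snd\<close>,
    so an arc is known from its ends and the arc map has no freedom.\<close>
  have "iso_arcs h e = map_prod (iso_verts h) (iso_verts h) e" if "e \<in> parcs G" for e
    using h that eqs(3,4)
    by (auto simp: pre_digraph.digraph_isomorphism_def prod_eq_iff)
  then have "parcs H = map_prod (iso_verts h) (iso_verts h) ` parcs G"
    unfolding eqs(2) by (rule image_cong[OF refl])
  then show ?thesis
    using h eqs(1) by (intro that[of "iso_verts h"])
      (auto simp: pre_digraph.digraph_isomorphism_def wf_digraph_wp_iff)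
qed

text \<open>Replaces subgraphs and isomorphisms by one map that preserves and reflects arcs: the
  inverse of the isomorphism in one direction, the subgraph induced on the image of \<open>g\<close>
  in the other.\<close>

lemma induced_free_iff:
  assumes "pair_wf_digraph G" "pair_wf_digraph H"
  shows "induced_free H G \<longleftrightarrow> \<not> (\<exists>g. inj_on g (pverts H) \<and> g ` pverts H \<subseteq> pverts G \<and>
    (\<forall>x \<in> pverts H. \<forall>y \<in> pverts H. (g x, g y) \<in> parcs G \<longleftrightarrow> (x, y) \<in> parcs H))"
proof -
  define emb where "emb g \<longleftrightarrow> inj_on g (pverts H) \<and> g ` pverts H \<subseteq> pverts G \<and>
    (\<forall>x \<in> pverts H. \<forall>y \<in> pverts H. (g x, g y) \<in> parcs G \<longleftrightarrow> (x, y) \<in> parcs H)" for g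
  interpret G: pair_wf_digraph G by fact
  interpret H: pair_wf_digraph H by fact
  have "\<exists>g. emb g" if ind: "induced_subgraph (with_proj S) (with_proj G)" and "graph_iso S H" for S
  proof -
    obtain f where S: "pair_wf_digraph S" and inj: "inj_on f (pverts S)"
      and verts: "pverts H = f ` pverts S" and arcs: "parcs H = map_prod f f ` parcs S"
      using graph_isoE[OF \<open>graph_iso S H\<close>] by metis
    have SG: "pverts S \<subseteq> pverts G"
      "parcs S = {e \<in> parcs G. fst e \<in> pverts S \<and> snd e \<in> pverts S}"
      using ind by (auto simp: induced_subgraph_def subgraph_def)
    let ?g = "the_inv_into (pverts S) f"
    have g: "?g (f x) = x" if "x \<in> pverts S" for x
      using inj that by (rule the_inv_into_f_f)
    have iff: "(f x, f y) \<in> parcs H \<longleftrightarrow> (x, y) \<in> parcs G" if "x \<in> pverts S" "y \<in> pverts S" for x y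
    proof
      assume "(f x, f y) \<in> parcs H"
      then obtain x' y' where "(x', y') \<in> parcs S" "f x' = f x" "f y' = f y"
        unfolding arcs by auto
      then show "(x, y) \<in> parcs G"
        using that inj_onD[OF inj] SG by (metis (mono_tags, lifting) S[THEN pair_wf_digraph.in_arcsD1]
          S[THEN pair_wf_digraph.in_arcsD2] mem_Collect_eq)
    next
      assume "(x, y) \<in> parcs G"
      then show "(f x, f y) \<in> parcs H"
        using that SG(2) unfolding arcs by force
    qed
    have "emb ?g"
      using SG(1) iff unfolding emb_def verts by (auto simp: g inj_on_def)
    then show ?thesis by blast
  qed
  moreover have "\<exists>S. induced_subgraph (with_proj S) (with_proj G) \<and> graph_iso S H" if "emb g" for g
  proof -
    let ?S = "\<lparr>pverts = g ` pverts H, parcs = {e \<in> parcs G. fst e \<in> g ` pverts H \<and> snd e \<in> g ` pverts H}\<rparr>"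
    have S: "pair_wf_digraph ?S"
      by unfold_locales auto
    have "induced_subgraph (with_proj ?S) (with_proj G)"
      using that S G.wf_digraph_axioms
      by (auto simp: emb_def induced_subgraph_def subgraph_def wf_digraph_wp_iff compatible_def)
    moreover have "graph_iso ?S H"
      using that unfolding emb_def by (intro graph_isoI[where f = "the_inv_into (pverts H) g"] S assms(2))
        (auto simp: the_inv_into_f_f image_image inj_on_def)
    ultimately show ?thesis by blast
  qed
  ultimately have "induced_free H G \<longleftrightarrow> \<not> (\<exists>g. emb g)"
    unfolding induced_free_def by blast
  then show ?thesis unfolding emb_def .
qed

section \<open>Induced 4-cycles and 5-cycles as tuples of vertices\<close>

lemma pair_wf_digraph_cycle_graph: "pair_wf_digraph (cycle_graph n)"
  by unfold_locales (auto simp: cycle_graph_def)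

text \<open>Meant for a \<open>pair_graph\<close>, where symmetry gives the reverse arcs and
  looplessness separates consecutive vertices. Opposite vertices of a 4-cycle have the same
  neighbours on it, so their distinctness must be demanded.\<close>

definition induced_C4 :: "'a pair_pre_digraph \<Rightarrow> 'a \<Rightarrow> 'a \<Rightarrow> 'a \<Rightarrow> 'a \<Rightarrow> bool" where
  "induced_C4 G a b c d \<longleftrightarrow> {(a, b), (b, c), (c, d), (d, a)} \<subseteq> parcs G \<and>
     (a, c) \<notin> parcs G \<and> (b, d) \<notin> parcs G \<and> a \<noteq> c \<and> b \<noteq> d"

lemma lessThan_4: "{..<4::nat} = {0, 1, 2, 3}" and lessThan_5: "{..<5::nat} = {0, 1, 2, 3, 4}"
  by auto

lemma parcs_cycle_graph_4: "parcs (cycle_graph 4) =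
    {(0, 1), (1, 2), (2, 3), (3, 0), (1, 0), (2, 1), (3, 2), (0, 3)}"
  and parcs_cycle_graph_5: "parcs (cycle_graph 5) =
    {(0, 1), (1, 2), (2, 3), (3, 4), (4, 0), (1, 0), (2, 1), (3, 2), (4, 3), (0, 4)}"
proof -
  \<comment> \<open>As images of an explicit finite set, the arcs can be enumerated by
    simplification.\<close>
  have "parcs (cycle_graph n) = (\<lambda>i. (i, (i + 1) mod n)) ` {..<n} \<union>
      (\<lambda>i. ((i + 1) mod n, i)) ` {..<n}" for n
    by (auto simp: cycle_graph_def)
  then show "parcs (cycle_graph 4) =
      {(0, 1), (1, 2), (2, 3), (3, 0), (1, 0), (2, 1), (3, 2), (0, 3)}"
    "parcs (cycle_graph 5) =
      {(0, 1), (1, 2), (2, 3), (3, 4), (4, 0), (1, 0), (2, 1), (3, 2), (4, 3), (0, 4)}"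
    by (simp_all add: lessThan_4 lessThan_5 insert_commute del: One_nat_def)
qed

context pair_graph
begin

lemma arcs_commute: "(x, y) \<in> parcs G \<longleftrightarrow> (y, x) \<in> parcs G"
  by (blast intro: arcs_symmetric)

lemma non_arc_sym: "(x, y) \<notin> parcs G \<Longrightarrow> (y, x) \<notin> parcs G"
  by (blast intro: arcs_symmetric)

lemma no_self_arc: "(x, x) \<notin> parcs G"
  using no_loops' by blast

lemma induced_C4_rotate: "induced_C4 G a b c d \<Longrightarrow> induced_C4 G b c d a"
  by (auto simp: induced_C4_def arcs_commute)

lemma induced_C4_free_iff:
  "induced_free (cycle_graph 4) G \<longleftrightarrow> \<not> (\<exists>a b c d. induced_C4 G a b c d)"
proof -
  let ?C = "cycle_graph 4"
  have verts: "pverts ?C = {0, 1, 2, 3}"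
    unfolding lessThan_4[symmetric] by (simp add: cycle_graph_def)
  define emb where "emb g \<longleftrightarrow> inj_on g (pverts ?C) \<and> g ` pverts ?C \<subseteq> pverts G \<and>
    (\<forall>x \<in> pverts ?C. \<forall>y \<in> pverts ?C. (g x, g y) \<in> parcs G \<longleftrightarrow> (x, y) \<in> parcs ?C)" for g
  have "induced_C4 G (g 0) (g 1) (g 2) (g 3)" if "emb g" for g
    using that unfolding emb_def induced_C4_def verts parcs_cycle_graph_4 by simp
  moreover have "\<exists>g. emb g" if "induced_C4 G a b c d" for a b c d
  proof -
    define g where "g = (\<lambda>i. [a, b, c, d] ! i)"
    have [simp]: "g 0 = a" "g (Suc 0) = b" "g 2 = c" "g 3 = d"
      by (simp_all add: g_def numeral_eq_Suc)
    have arcs: "(a, b) \<in> parcs G" "(b, c) \<in> parcs G" "(c, d) \<in> parcs G" "(d, a) \<in> parcs G"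
      "(a, c) \<notin> parcs G" "(b, d) \<notin> parcs G" "a \<noteq> c" "b \<noteq> d"
      using that by (auto simp: induced_C4_def)
    have "a \<noteq> b" "b \<noteq> c" "c \<noteq> d" "d \<noteq> a"
      using arcs(1-4) no_loops' by auto
    moreover have "{a, b, c, d} \<subseteq> pverts G"
      using arcs(1-4) by (auto dest: in_arcsD1)
    ultimately show ?thesis
      using arcs arcs(1-4)[THEN arcs_symmetric] arcs(5,6)[THEN non_arc_sym]
      unfolding emb_def verts parcs_cycle_graph_4
      by (intro exI[of _ g]) (auto simp: no_self_arc)
  qed
  moreover have "induced_free ?C G \<longleftrightarrow> \<not> (\<exists>g. emb g)"
    unfolding emb_def by (rule induced_free_iff[OF pair_wf_digraph pair_wf_digraph_cycle_graph])
  ultimately show ?thesis by blast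
qed

lemma not_induced_C5_freeI:
  assumes arcs: "(a, b) \<in> parcs G" "(b, c) \<in> parcs G" "(c, d) \<in> parcs G" "(d, e) \<in> parcs G" "(e, a) \<in> parcs G"
    and non_arcs: "(a, c) \<notin> parcs G" "(b, d) \<notin> parcs G" "(c, e) \<notin> parcs G" "(d, a) \<notin> parcs G" "(e, b) \<notin> parcs G"
  shows "\<not> induced_free (cycle_graph 5) G"
proof -
  let ?C = "cycle_graph 5"
  have verts: "pverts ?C = {0, 1, 2, 3, 4}"
    unfolding lessThan_5[symmetric] by (simp add: cycle_graph_def)
  define g where "g = (\<lambda>i. [a, b, c, d, e] ! i)"
  have [simp]: "g 0 = a" "g (Suc 0) = b" "g 2 = c" "g 3 = d" "g 4 = e"
    by (simp_all add: g_def numeral_eq_Suc)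
  note sym = arcs[THEN arcs_symmetric] non_arcs[THEN non_arc_sym]
  \<comment> \<open>Adjacent vertices differ as there are no loops. Nonadjacent ones are told apart
    by a third vertex: \<open>e\<close> is adjacent to \<open>a\<close> but not to \<open>c\<close>,
    and likewise for the other pairs.\<close>
  have "distinct [a, b, c, d, e]"
    using arcs non_arcs sym no_self_arc by auto
  moreover have "{a, b, c, d, e} \<subseteq> pverts G"
    using arcs by (auto dest: in_arcsD1)
  ultimately show ?thesis
    using arcs non_arcs sym
    unfolding induced_free_iff[OF pair_wf_digraph pair_wf_digraph_cycle_graph] not_not
      verts parcs_cycle_graph_5
    by (intro exI[of _ g]) (auto simp: no_self_arc)
qed

section \<open>Contraction of an edge in a graph without induced 5-cycles\<close>

lemma parcs_contract_edge [simp]: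
  "(Some x, Some y) \<in> parcs (contract_edge G (u, v)) \<longleftrightarrow>
     (x, y) \<in> parcs G \<and> x \<notin> {u, v} \<and> y \<notin> {u, v}"
  "(None, Some x) \<in> parcs (contract_edge G (u, v)) \<longleftrightarrow>
     x \<notin> {u, v} \<and> ((u, x) \<in> parcs G \<or> (v, x) \<in> parcs G)"
  "(Some x, None) \<in> parcs (contract_edge G (u, v)) \<longleftrightarrow>
     x \<notin> {u, v} \<and> ((u, x) \<in> parcs G \<or> (v, x) \<in> parcs G)"
  "(None, None) \<notin> parcs (contract_edge G (u, v))"
  by (auto simp: Let_def neighbours_def)

lemma pair_graph_contract_edge: "pair_graph (contract_edge G (u, v))"
proof -
  let ?H = "contract_edge G (u, v)"
  have verts: "pverts ?H = insert None (Some ` (pverts G - {u, v}))"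
    by (simp add: Let_def)
  have sub: "parcs ?H \<subseteq> pverts ?H \<times> pverts ?H"
  proof (rule subrelI)
    fix p q assume "(p, q) \<in> parcs ?H"
    then show "(p, q) \<in> pverts ?H \<times> pverts ?H"
      \<comment> \<open>Here and below the contraction is kept folded, so that
        \<open>parcs_contract_edge\<close> can rewrite arc membership.\<close>
      unfolding verts by (cases p; cases q) (auto simp del: contract_edge.simps dest: in_arcsD1 in_arcsD2)
  qed
  have fin: "finite (pverts ?H)"
    unfolding verts using pair_finite_verts by simp
  have "sym (parcs ?H)"
  proof (rule symI)
    fix p q assume "(p, q) \<in> parcs ?H"
    then show "(q, p) \<in> parcs ?H"
      by (cases p; cases q) (auto simp del: contract_edge.simps intro: arcs_symmetric)
  qed
  moreover have "(p, p) \<notin> parcs ?H" for p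
    by (cases p) (simp_all del: contract_edge.simps add: no_self_arc)
  ultimately show ?thesis
    using sub fin finite_subset[OF sub]
    by unfold_locales (auto simp del: contract_edge.simps simp: symmetric_def)
qed

lemma contract_edge_induced_C4_free_iff:
  "induced_free (cycle_graph 4) (contract_edge G (u, v)) \<longleftrightarrow>
     \<not> (\<exists>a b c d. induced_C4 (contract_edge G (u, v)) a b c d)"
  using pair_graph_contract_edge by (rule pair_graph.induced_C4_free_iff)

text \<open>Neither end of \<open>uv\<close> sees \<open>b\<close>. If one end sees both
  \<open>a\<close> and \<open>c\<close>, it can replace the new vertex. Otherwise one end sees only
  \<open>a\<close> and the other only \<open>c\<close>, and the two ends with \<open>a\<close>,
  \<open>b\<close>, \<open>c\<close> form an induced 5-cycle.\<close>

lemma induced_C4_through_contracted: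
  assumes C5: "induced_free (cycle_graph 5) G"
    and uv: "(u, v) \<in> parcs G"
    and C4: "induced_C4 (contract_edge G (u, v)) None (Some a) (Some b) (Some c)"
  shows "\<exists>a b c d. induced_C4 G a b c d"
proof -
  have facts: "(a, b) \<in> parcs G" "(b, c) \<in> parcs G" "(a, c) \<notin> parcs G" "a \<noteq> c"
    "(u, b) \<notin> parcs G" "(v, b) \<notin> parcs G" "b \<noteq> u" "b \<noteq> v"
    and a: "(u, a) \<in> parcs G \<or> (v, a) \<in> parcs G" and c: "(u, c) \<in> parcs G \<or> (v, c) \<in> parcs G"
    using C4 by (auto simp del: contract_edge.simps simp: induced_C4_def)
  have both: ?thesis if "(w, a) \<in> parcs G" "(w, c) \<in> parcs G" "(w, b) \<notin> parcs G" "w \<noteq> b" for w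
    using facts that arcs_commute by (intro exI[of _ w] exI[of _ a] exI[of _ b] exI[of _ c])
      (auto simp: induced_C4_def)
  have False if "(w, a) \<in> parcs G" "(z, c) \<in> parcs G" "(w, c) \<notin> parcs G" "(z, a) \<notin> parcs G"
    "(w, z) \<in> parcs G" "(w, b) \<notin> parcs G" "(z, b) \<notin> parcs G" for w z
    using not_induced_C5_freeI[of w a b c z] C5 facts that arcs_commute by blast
  with both show ?thesis
    using a c facts uv arcs_commute by metis
qed

lemma contract_edge_induced_C4_free:
  assumes "induced_free (cycle_graph 5) G" and C4: "induced_free (cycle_graph 4) G"
    and "(u, v) \<in> parcs G"
  shows "induced_free (cycle_graph 4) (contract_edge G (u, v))"
proof -
  let ?H = "contract_edge G (u, v)"
  note rotate = pair_graph.induced_C4_rotate[OF pair_graph_contract_edge]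
  have no_C4: "\<not> induced_C4 G a b c d" for a b c d
    using C4 by (simp add: induced_C4_free_iff)
  have no_None: "\<not> induced_C4 ?H None p q r" for p q r
  proof
    assume *: "induced_C4 ?H None p q r"
    then have "p \<noteq> None" "q \<noteq> None" "r \<noteq> None"
      by (metis induced_C4_def insert_subset parcs_contract_edge(4))+
    with * show False
      using induced_C4_through_contracted[OF assms(1,3)] no_C4 by blast
  qed
  have "\<not> induced_C4 ?H p q r s" for p q r s
  proof
    assume *: "induced_C4 ?H p q r s"
    then have "p \<noteq> None" "q \<noteq> None" "r \<noteq> None" "s \<noteq> None"
      \<comment> \<open>Rotation would bring a new vertex in any position to the front.\<close>
      using no_None rotate by metis+
    then obtain p' q' r' s' where "p = Some p'" "q = Some q'" "r = Some r'" "s = Some s'"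
      by blast
    with * have "induced_C4 G p' q' r' s'"
      by (auto simp del: contract_edge.simps simp: induced_C4_def)
    with no_C4 show False by blast
  qed
  then show ?thesis
    by (simp add: contract_edge_induced_C4_free_iff del: contract_edge.simps)
qed

end

section \<open>Graphs with an induced 4-cycle whose contractions have none\<close>

locale critical_C4 = pair_graph +
  fixes a b c d
  assumes contractions: "\<And>e. e \<in> parcs G \<Longrightarrow> induced_free (cycle_graph 4) (contract_edge G e)"
    and not_isolated: "no_isolated_verts G"
    and C4: "induced_C4 G a b c d"
begin

abbreviation outer :: "'a set" where
  "outer \<equiv> pverts G - {a, b, c, d}"

text \<open>Contracting an edge disjoint from a 4-cycle leaves the cycle intact. The cycle is
  arbitrary because cycles other than \<open>a b c d\<close> are needed later.\<close>

lemma no_arc_avoids_C4: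
  assumes "induced_C4 G p q r s" "x \<notin> {p, q, r, s}" "y \<notin> {p, q, r, s}"
  shows "(x, y) \<notin> parcs G"
proof
  assume "(x, y) \<in> parcs G"
  then have "\<not> induced_C4 (contract_edge G (x, y)) (Some p) (Some q) (Some r) (Some s)"
    using contractions contract_edge_induced_C4_free_iff by blast
  with assms show False
    by (auto simp del: contract_edge.simps simp: induced_C4_def)
qed

text \<open>If \<open>x\<close> missed \<open>r\<close>, then after contracting \<open>xp\<close>
  the new vertex would still see \<open>q\<close> and \<open>s\<close> but not \<open>r\<close>, and
  so would replace \<open>p\<close> in the 4-cycle.\<close>

lemma adjacent_opposite:
  assumes "induced_C4 G p q r s" "x \<notin> {p, q, r, s}" "(x, p) \<in> parcs G"
  shows "(x, r) \<in> parcs G"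
proof (rule ccontr)
  assume "(x, r) \<notin> parcs G"
  moreover have arcs: "(p, q) \<in> parcs G" "(q, r) \<in> parcs G" "(r, s) \<in> parcs G" "(p, s) \<in> parcs G"
    "(q, s) \<notin> parcs G" "(p, r) \<notin> parcs G" "q \<noteq> s" "p \<noteq> r"
    using assms(1) arcs_symmetric by (auto simp: induced_C4_def)
  moreover have "p \<noteq> q" "p \<noteq> s"
    using arcs no_self_arc by blast+
  ultimately have "induced_C4 (contract_edge G (x, p)) None (Some q) (Some r) (Some s)"
    using assms(2) by (auto simp del: contract_edge.simps simp: induced_C4_def)
  then show False
    using assms(3) contractions contract_edge_induced_C4_free_iff by blast
qed

lemma cycle_arcs:
  "(a, b) \<in> parcs G" "(b, c) \<in> parcs G" "(c, d) \<in> parcs G" "(d, a) \<in> parcs G"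
  "(b, a) \<in> parcs G" "(c, b) \<in> parcs G" "(d, c) \<in> parcs G" "(a, d) \<in> parcs G"
  "(a, c) \<notin> parcs G" "(b, d) \<notin> parcs G" "(c, a) \<notin> parcs G" "(d, b) \<notin> parcs G"
  using C4 by (simp_all add: induced_C4_def arcs_commute)

lemma cycle_distinct: "distinct [a, b, c, d]"
  using C4[unfolded induced_C4_def] cycle_arcs(1-4)[THEN no_loops'] by simp

lemma cycle_verts: "{a, b, c, d} \<subseteq> pverts G"
  using cycle_arcs(1-4)[THEN in_arcsD1] by simp

lemma outer_independent: "x \<in> outer \<Longrightarrow> y \<in> outer \<Longrightarrow> (x, y) \<notin> parcs G"
  using no_arc_avoids_C4[OF C4] by blast

lemma outer_opposite:
  assumes "x \<in> outer"
  shows "(x, a) \<in> parcs G \<longleftrightarrow> (x, c) \<in> parcs G" "(x, b) \<in> parcs G \<longleftrightarrow> (x, d) \<in> parcs G"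
proof -
  \<comment> \<open>\<open>adjacent_opposite\<close> yields one implication for each starting
    vertex; the four rotations yield both equivalences.\<close>
  note C4_b = induced_C4_rotate[OF C4]
  note C4_c = induced_C4_rotate[OF C4_b]
  note C4_d = induced_C4_rotate[OF C4_c]
  show "(x, a) \<in> parcs G \<longleftrightarrow> (x, c) \<in> parcs G" "(x, b) \<in> parcs G \<longleftrightarrow> (x, d) \<in> parcs G"
    using assms adjacent_opposite[OF C4, of x] adjacent_opposite[OF C4_b, of x]
      adjacent_opposite[OF C4_c, of x] adjacent_opposite[OF C4_d, of x]
    by auto
qed

text \<open>A neighbour of \<open>x\<close> exists and lies on the cycle since outer vertices are
  independent; \<open>outer_opposite\<close> trades \<open>c\<close> for \<open>a\<close> and
  \<open>d\<close> for \<open>b\<close>.\<close>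

lemma outer_adjacent:
  assumes "x \<in> outer"
  shows "(x, a) \<in> parcs G \<or> (x, b) \<in> parcs G"
proof -
  obtain y where "(x, y) \<in> parcs G"
    using assms not_isolated by (auto simp: no_isolated_verts_def neighbours_def)
  then have "y \<in> {a, b, c, d}"
    using assms outer_independent in_arcsD2 by blast
  then show ?thesis
    using \<open>(x, y) \<in> parcs G\<close> outer_opposite[OF assms] by blast
qed

lemma outer_same_type:
  assumes x: "x \<in> outer" "(x, a) \<in> parcs G" "(x, b) \<notin> parcs G" and y: "y \<in> outer"
  shows "(y, b) \<notin> parcs G"
proof
  assume yb: "(y, b) \<in> parcs G"
  have xy: "(y, x) \<notin> parcs G" "y \<noteq> x"
    using outer_independent x y yb by auto
  \<comment> \<open>The vertex \<open>x\<close> takes the place of \<open>d\<close>, opposite to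
    \<open>b\<close>. Seeing \<open>b\<close>, the vertex \<open>y\<close> would have to see
    \<open>x\<close>, another outer vertex.\<close>
  have "induced_C4 G b c x a"
    using x outer_opposite[OF x(1)] cycle_arcs cycle_distinct arcs_symmetric[of x c] non_arc_sym[of x b]
    by (auto simp: induced_C4_def)
  from adjacent_opposite[OF this _ yb] xy y show False by blast
qed

section \<open>Recognising the exceptional graphs\<close>

lemma complete_bipartite:
  assumes "\<And>x. x \<in> outer \<Longrightarrow> (x, b) \<notin> parcs G"
  shows "\<exists>m \<ge> 2. K\<^bsub>2,m\<^esub> (with_proj G)"
proof -
  \<comment> \<open>The second side, opposite \<open>{a, c}\<close>; \<open>b\<close> and
    \<open>d\<close> ensure that it has at least two vertices, even if \<open>outer\<close> is
    empty.\<close>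
  define V where "V = outer \<union> {b, d}"
  \<comment> \<open>Missing \<open>b\<close> entails missing \<open>d\<close>; then
    \<open>outer_adjacent\<close> forces \<open>a\<close>, hence \<open>c\<close>.\<close>
  have nb: "(x, a) \<in> parcs G" "(x, c) \<in> parcs G" "(x, b) \<notin> parcs G" "(x, d) \<notin> parcs G"
    if "x \<in> outer" for x
    using assms that outer_adjacent outer_opposite by blast+
  have VU: "(x, y) \<in> parcs G" if "x \<in> V" "y \<in> {a, c}" for x y
    using that nb cycle_arcs unfolding V_def by blast
  have UV: "(x, y) \<in> parcs G" if "x \<in> {a, c}" "y \<in> V" for x y
    by (rule arcs_symmetric[OF VU[OF that(2,1)]])
  have UU: "(x, y) \<notin> parcs G" if "x \<in> {a, c}" "y \<in> {a, c}" for x y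
    using that cycle_arcs no_self_arc by blast
  have VV: "(x, y) \<notin> parcs G" if xy: "x \<in> V" "y \<in> V" for x y
  proof -
    consider "x \<in> outer" "y \<in> outer" | "x \<in> outer" "y \<in> {b, d}" | "x \<in> {b, d}" "y \<in> outer"
      | "x \<in> {b, d}" "y \<in> {b, d}"
      using xy unfolding V_def by blast
    then show ?thesis
    proof cases
      case 1
      then show ?thesis by (rule outer_independent)
    next
      case 2
      then show ?thesis using nb[of x] by blast
    next
      case 3
      then have "(y, x) \<notin> parcs G" using nb[of y] by blast
      then show ?thesis by (rule non_arc_sym)
    next
      case 4
      then show ?thesis using cycle_arcs no_self_arc by auto
    qed
  qed
  have verts: "pverts G = {a, c} \<union> V"
    using cycle_verts unfolding V_def by blast
  have "parcs G = {a, c} \<times> V \<union> V \<times> {a, c}"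
  proof (intro subset_antisym subrelI)
    fix x y assume xy: "(x, y) \<in> parcs G"
    then have "x \<in> {a, c} \<union> V" "y \<in> {a, c} \<union> V"
      unfolding verts[symmetric] by (auto dest: in_arcsD1 in_arcsD2)
    then show "(x, y) \<in> {a, c} \<times> V \<union> V \<times> {a, c}"
      using xy UU VV by blast
  qed (use UV VU in blast)
  moreover note verts
  moreover have "{a, c} \<inter> V = {}" "card {a, c} = 2"
    using cycle_distinct by (auto simp: V_def)
  ultimately have "K\<^bsub>2,card V\<^esub> (with_proj G)"
    using pair_finite_verts unfolding complete_bipartite_digraph_pair_def by blast
  moreover have "card {b, d} \<le> card V"
    using pair_finite_verts by (intro card_mono) (auto simp: V_def)
  then have "2 \<le> card V"
    using cycle_distinct by simp
  ultimately show ?thesis by blast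
qed

lemma outer_card_le_2:
  assumes full: "\<And>x. x \<in> outer \<Longrightarrow> (x, a) \<in> parcs G \<and> (x, b) \<in> parcs G"
    and x: "x \<in> outer" and y: "y \<in> outer" and "x \<noteq> y"
  shows "outer = {x, y}"
proof (rule ccontr)
  assume "outer \<noteq> {x, y}"
  then obtain z where z: "z \<in> outer" "z \<noteq> x" "z \<noteq> y"
    using x y by blast
  \<comment> \<open>This cycle avoids \<open>b\<close>, so an edge from a third outer vertex
    \<open>z\<close> to \<open>b\<close> would be disjoint from it.\<close>
  have "induced_C4 G a x c y"
    using full[OF x] full[OF y] outer_opposite[OF x] outer_opposite[OF y] outer_independent[OF x y]
      \<open>x \<noteq> y\<close> cycle_arcs cycle_distinct arcs_symmetric[of x a] arcs_symmetric[of y c]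
    by (auto simp: induced_C4_def)
  then have "(z, b) \<notin> parcs G"
    by (rule no_arc_avoids_C4) (use z x y cycle_distinct in auto)
  with full[OF z(1)] show False by blast
qed

lemma wheel:
  assumes "outer = {x}" and "(x, a) \<in> parcs G" "(x, b) \<in> parcs G"
  shows "graph_iso G (wheel_graph 4)"
proof -
  have x: "x \<in> outer" using assms(1) by blast
  have x_arcs: "(x, a) \<in> parcs G" "(x, b) \<in> parcs G" "(x, c) \<in> parcs G" "(x, d) \<in> parcs G"
    using assms(2,3) outer_opposite[OF x] by auto
  \<comment> \<open>The 4-cycle becomes the rim, in order; the default \<open>None\<close> sends
    \<open>x\<close> to the hub.\<close>
  define f where "f = (\<lambda>v. if v = a then Some 0 else if v = b then Some 1 else if v = c then Some 2
    else if v = d then Some 3 else None :: nat option)"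
  have dist: "distinct [a, b, c, d, x]"
    using cycle_distinct x by auto
  have f: "f a = Some 0" "f b = Some 1" "f c = Some 2" "f d = Some 3" "f x = None"
    using dist by (auto simp: f_def)
  have verts: "pverts G = {a, b, c, d, x}"
    using assms(1) cycle_verts by blast
  have wheel_verts: "pverts (wheel_graph 4) = {None, Some 0, Some 1, Some 2, Some 3}"
    by (simp add: wheel_graph_def lessThan_4)
  have wheel_arcs: "(None, None) \<notin> parcs (wheel_graph n)"
    "(None, Some i) \<in> parcs (wheel_graph n) \<longleftrightarrow> i < n"
    "(Some i, None) \<in> parcs (wheel_graph n) \<longleftrightarrow> i < n"
    "(Some i, Some j) \<in> parcs (wheel_graph n) \<longleftrightarrow> (i, j) \<in> parcs (cycle_graph n)" for n i j
    by (auto simp: wheel_graph_def)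
  show ?thesis
  proof (rule graph_isoI)
    show "pair_wf_digraph (wheel_graph 4)"
      by unfold_locales (auto simp: wheel_graph_def cycle_graph_def)
    show "inj_on f (pverts G)" "f ` pverts G = pverts (wheel_graph 4)"
      unfolding verts wheel_verts by (auto simp: f)
    show "(f p, f q) \<in> parcs (wheel_graph 4) \<longleftrightarrow> (p, q) \<in> parcs G"
      if "p \<in> pverts G" "q \<in> pverts G" for p q
      using that cycle_arcs x_arcs x_arcs[THEN arcs_symmetric] unfolding verts
      by (auto simp: f wheel_arcs parcs_cycle_graph_4 no_self_arc)
  qed (rule pair_wf_digraph)
qed

lemma octahedron:
  assumes "outer = {x, y}" "x \<noteq> y" and "(x, a) \<in> parcs G" "(x, b) \<in> parcs G"
    and "(y, a) \<in> parcs G" "(y, b) \<in> parcs G"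
  shows "graph_iso G (complete_multipartite_graph [2, 2, 2])"
proof -
  let ?H = "complete_multipartite_graph [2, 2, 2]"
  have xy: "x \<in> outer" "y \<in> outer" using assms(1) by blast+
  have xy_arcs: "(x, a) \<in> parcs G" "(x, b) \<in> parcs G" "(x, c) \<in> parcs G" "(x, d) \<in> parcs G"
    "(y, a) \<in> parcs G" "(y, b) \<in> parcs G" "(y, c) \<in> parcs G" "(y, d) \<in> parcs G"
    using assms(3-6) outer_opposite[OF xy(1)] outer_opposite[OF xy(2)] by auto
  have xy_non: "(x, y) \<notin> parcs G" "(y, x) \<notin> parcs G"
    using xy outer_independent by blast+
  \<comment> \<open>The parts are the three nonadjacent pairs \<open>{a, c}\<close>,
    \<open>{b, d}\<close>, \<open>{x, y}\<close>; the default value is that of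
    \<open>y\<close>.\<close>
  define f where "f = (\<lambda>v. if v = a then (0, 0) else if v = c then (0, 1) else if v = b then (1, 0)
    else if v = d then (1, 1) else if v = x then (2, 0) else (2, 1) :: nat \<times> nat)"
  have dist: "distinct [a, b, c, d, x, y]"
    using cycle_distinct xy \<open>x \<noteq> y\<close> by auto
  have f: "f a = (0, 0)" "f c = (0, 1)" "f b = (1, 0)" "f d = (1, 1)" "f x = (2, 0)" "f y = (2, 1)"
    using dist by (auto simp: f_def)
  have verts: "pverts G = {a, b, c, d, x, y}"
    using assms(1) cycle_verts by blast
  have "{(i, k). i < length [2, 2, 2 :: nat] \<and> k < [2, 2, 2] ! i} = {..<3} \<times> {..<2 :: nat}"
    by (auto simp: less_Suc_eq numeral_eq_Suc)
  also have "\<dots> = {(0, 0), (0, 1), (1, 0), (1, 1), (2, 0), (2, 1)}"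
    by (auto simp: less_Suc_eq numeral_eq_Suc)
  finally have H_verts: "pverts ?H = {(0, 0), (0, 1), (1, 0), (1, 1), (2, 0), (2, 1)}"
    by (simp add: complete_multipartite_graph_def Let_def)
  have H_arcs: "(p, q) \<in> parcs ?H \<longleftrightarrow> p \<in> pverts ?H \<and> q \<in> pverts ?H \<and> fst p \<noteq> fst q" for p q
    by (simp add: complete_multipartite_graph_def Let_def)
  show ?thesis
  proof (rule graph_isoI)
    show "pair_wf_digraph ?H"
      by unfold_locales (auto simp: H_arcs)
    show "inj_on f (pverts G)" "f ` pverts G = pverts ?H"
      unfolding verts H_verts by (auto simp: f)
    show "(f p, f q) \<in> parcs ?H \<longleftrightarrow> (p, q) \<in> parcs G"
      if "p \<in> pverts G" "q \<in> pverts G" for p q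
      using that cycle_arcs xy_arcs xy_arcs[THEN arcs_symmetric] xy_non unfolding verts
      by (elim insertE emptyE) (simp_all add: f H_arcs H_verts no_self_arc)
  qed (rule pair_wf_digraph)
qed

text \<open>Starting the cycle at \<open>b\<close> exchanges the roles of \<open>{a, c}\<close> and
  \<open>{b, d}\<close>, so type \<open>{b, d}\<close> needs no separate argument.\<close>

lemma rotated: "critical_C4 G b c d a"
  by unfold_locales (erule contractions | rule not_isolated induced_C4_rotate[OF C4])+

theorem exceptional_graph:
  "(\<exists>m \<ge> 2. K\<^bsub>2,m\<^esub> (with_proj G)) \<or> graph_iso G (wheel_graph 4) \<or>
     graph_iso G (complete_multipartite_graph [2, 2, 2])"
\<comment> \<open>If every outer vertex sees the whole cycle, their number decides: none gives
  K_{2,2}, one the wheel, two or more the octahedron. Otherwise some vertex has type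
  \<open>{a, c}\<close> or \<open>{b, d}\<close>, and it imposes its type on all.\<close>
proof (cases "\<forall>x \<in> outer. (x, a) \<in> parcs G \<and> (x, b) \<in> parcs G")
  case True
  note full = bspec[OF True]
  have "S = {} \<or> (\<exists>x. S = {x}) \<or> (\<exists>x y. x \<in> S \<and> y \<in> S \<and> x \<noteq> y)" for S :: "'a set"
    by blast
  from this[of outer] consider "outer = {}" | x where "outer = {x}"
    | x y where "x \<in> outer" "y \<in> outer" "x \<noteq> y"
    by meson
  then show ?thesis
  proof cases
    case 1
    have "\<exists>m \<ge> 2. K\<^bsub>2,m\<^esub> (with_proj G)"
      by (rule complete_bipartite) (simp only: 1 empty_iff)
    then show ?thesis ..
  next
    case (2 x)
    then have "x \<in> outer" by (simp only: insertI1)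
    then show ?thesis using wheel[OF 2] full by simp
  next
    case (3 x y)
    note outer_eq = outer_card_le_2[OF full 3]
    show ?thesis
      using octahedron[OF outer_eq 3(3)] full[OF 3(1)] full[OF 3(2)] by simp
  qed
next
  case False
  interpret rot: critical_C4 G b c d a by (rule rotated)
  have outer_rot: "pverts G - {b, c, d, a} = outer"
    by (simp only: insert_commute)
  from False obtain x where x: "x \<in> outer" and "(x, a) \<notin> parcs G \<or> (x, b) \<notin> parcs G"
    by meson
  \<comment> \<open>The second case speaks of \<open>c\<close>, equivalent to \<open>a\<close> by
    \<open>outer_opposite\<close>, because it is then the first case for the cycle
    \<open>b c d a\<close>.\<close>
  then consider "(x, a) \<in> parcs G" "(x, b) \<notin> parcs G" | "(x, b) \<in> parcs G" "(x, c) \<notin> parcs G"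
    using outer_adjacent[OF x] outer_opposite[OF x] by blast
  then have "\<exists>m \<ge> 2. K\<^bsub>2,m\<^esub> (with_proj G)"
  proof cases
    case 1
    show ?thesis
      by (rule complete_bipartite[OF outer_same_type[OF x 1]])
  next
    case 2
    show ?thesis
      by (rule rot.complete_bipartite[unfolded outer_rot, OF rot.outer_same_type[unfolded outer_rot, OF x 2]])
  qed
  then show ?thesis ..
qed

end

theorem theorem32:
  fixes G :: "'a pair_pre_digraph"
  assumes "pair_graph G"
    and "no_isolated_verts G"
    and "induced_free (cycle_graph 5) G"
    and "\<And>m. m \<ge> 2 \<Longrightarrow> \<not> K\<^bsub>2,m\<^esub> (with_proj G)"
    and "\<not> graph_iso G (wheel_graph 4)"
    and "\<not> graph_iso G (complete_multipartite_graph [2, 2, 2])"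
  shows "induced_free (cycle_graph 4) G \<longleftrightarrow>
    (\<forall>e \<in> parcs G. induced_free (cycle_graph 4) (contract_edge G e))"
proof -
  interpret pair_graph G by fact
  show ?thesis
  proof (intro iffI ballI)
    fix e assume "induced_free (cycle_graph 4) G" "e \<in> parcs G"
    then show "induced_free (cycle_graph 4) (contract_edge G e)"
      using contract_edge_induced_C4_free[OF assms(3)] by (cases e) blast
  next
    assume contractions: "\<forall>e \<in> parcs G. induced_free (cycle_graph 4) (contract_edge G e)"
    \<comment> \<open>An induced 4-cycle would make \<open>G\<close> one of the excluded
      graphs.\<close>
    have False if "induced_C4 G a b c d" for a b c d
    proof -
      interpret critical_C4 G a b c d
        using contractions assms(2) that by unfold_locales blast+
      show False using exceptional_graph assms(4-6) by blast
    qed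
    then show "induced_free (cycle_graph 4) G"
      unfolding induced_C4_free_iff by blast
  qed
qed

end
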